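(* Let $c>0$. For a given càdlàg function $f:[a;b]\rightarrow\mathbb{R}$ and for any $s\in(a;b]$ the following equalities hold: $$UTV^{c}\left(f,[a;s]\right)=f_{U}^{c}(s),$$ $$DTV^{c}\left(f,[a;s]\right)=f_{D}^{c}(s),$$ $$TV^{c}\left(f,[a;s]\right)=f_{U}^{c}(s)+f_{D}^{c}(s).$$
   Context: Let $-\infty<a<b<+\infty$. Càdlàg means right-continuous with left limits. For $s\in(a;b]$, $$TV^{c}(f,[a;s])=\sup_{n}\sup_{a\leq t_0<\ldots<t_n\leq s}\sum_{i=1}^{n}\max\{|f(t_i)-f(t_{i-1})|-c,0\},$$ $$UTV^{c}(f,[a;s])=\sup_{n}\sup_{a\leq t_0<\ldots<t_n\leq s}\sum_{i=1}^{n}\max\{f(t_i)-f(t_{i-1})-c,0\},$$ $$DTV^{c}(f,[a;s])=\sup_{n}\sup_{a\leq t_0<\ldots<t_n\leq s}\sum_{i=1}^{n}\max\{f(t_{i-1})-f(t_i)-c,0\}.$$ Construction of $f_U^c,f_D^c$. Convention: $\inf\emptyset=\infty$, and intervals below whose right endpoint may be $\infty$ are intersected with $[a;b]$. Define $$T_D^cf=\inf\{s\in[a;b]:\sup_{t\in[a;s]}f(t)-f(s)\ge c\},\qquad T_U^cf=\inf\{s\in[a;b]:f(s)-\inf_{t\in[a;s]}f(t)\ge c\}.$$ Case $T_D^cf\ge T_U^cf$. Put $T_{D,-1}^c=a$, $T_{U,0}^c=T_U^cf$ and for $k=0,1,2,\ldots$: $T_{D,k}^c=\inf\{s\in[T_{U,k}^c;b]:\sup_{t\in[T_{U,k}^c;s]}f(t)-f(s)\ge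 c\}$ if $T_{U,k}^c<b$, and $T_{D,k}^c=\infty$ if $T_{U,k}^c\ge b$; $T_{U,k+1}^c=\inf\{s\in[T_{D,k}^c;b]:f(s)-\inf_{t\in[T_{D,k}^c;s]}f(t)\ge c\}$ if $T_{D,k}^c<b$, and $T_{U,k+1}^c=\infty$ if $T_{D,k}^c\ge b$. (There is a finite $K$ with $T_{U,K}^c=\infty$ or $T_{D,K}^c=\infty$.) For $k$ with $T_{D,k-1}^c<\infty$ set $m_k^c(s)=\inf_{t\in[T_{D,k-1}^c;s]}f(t)$ for $s\in[T_{D,k-1}^c;T_{U,k}^c)$ and $m_k^c=\inf_{t\in[T_{D,k-1}^c;T_{U,k}^c)}f(t)$; for $k$ with $T_{U,k}^c<\infty$ set $M_k^c(s)=\sup_{t\in[T_{U,k}^c;s]}f(t)$ for $s\in[T_{U,k}^c;T_{D,k}^c)$ and $M_k^c=\sup_{t\in[T_{U,k}^c;T_{D,k}^c)}f(t)$. Define $f_U^c(s)=f_D^c(s)=0$ for $s\in[a;T_{U,0}^c)$; for $k=0,1,2,\ldots$ and $s\in[T_{U,k}^c;T_{D,k}^c)$, $$f_U^c(s)=\sum_{i=0}^{k-1}\{M_i^c-m_i^c-c\}+M_k^c(s)-m_k^c-c,\qquad f_D^c(s)=\sum_{i=0}^{k-1}\{M_i^c-m_{i+1}^c-c\};$$ for $s\in[T_{D,k}^c;T_{U,k+1}^c)$, $$f_U^c(s)=\sum_{i=0}^{k}\{M_i^c-m_i^c-c\},\qquad f_D^c(s)=\sum_{i=0}^{k-1}\{M_i^c-m_{i+1}^c-c\}+M_k^c-m_{k+1}^c(s)-c.$$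 Case $T_D^cf<T_U^cf$. Then $T_U^c(-f)=T_D^cf<T_U^cf=T_D^c(-f)$, so $-f$ satisfies $T_D^c(-f)\ge T_U^c(-f)$; let $(-f)_U^c,(-f)_D^c$ be the functions given by the definitions of the case $T_D^cf\ge T_U^cf$ (of $T_{U,k}^c$, $T_{D,k}^c$, $m_k^c(\cdot)$, $m_k^c$, $M_k^c(\cdot)$, $M_k^c$, $f_U^c$ and $f_D^c$) with $f$ replaced by $-f$ throughout, and set $f_U^c=(-f)_D^c$, $f_D^c=(-f)_U^c$. *)

theory Defs
  imports "HOL-Analysis.Analysis"
begin

text \<open>
  A function on the interval from \<open>a\<close> to \<open>b\<close> is given by a total function on the reals; no
  definition below depends on its values outside \<open>{a..b}\<close>.
\<close>

definition cadlag_on :: "real \<Rightarrow> real \<Rightarrow> (real \<Rightarrow> real) \<Rightarrow> bool" where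
  "cadlag_on a b f \<longleftrightarrow>
     (\<forall>t\<in>{a..<b}. (f \<longlongrightarrow> f t) (at_right t)) \<and>
     (\<forall>t\<in>{a<..b}. \<exists>l. (f \<longlongrightarrow> l) (at_left t))"


section \<open>Truncated variations\<close>

text \<open>Only the points \<open>t 0, \<dots>, t n\<close> matter; the suprema are taken in the extended reals.\<close>

definition partitions :: "real \<Rightarrow> real \<Rightarrow> nat \<Rightarrow> (nat \<Rightarrow> real) set" where
  "partitions a s n = {t. a \<le> t 0 \<and> (\<forall>i<n. t i < t (Suc i)) \<and> t n \<le> s}"

definition TV :: "real \<Rightarrow> (real \<Rightarrow> real) \<Rightarrow> real \<Rightarrow> real \<Rightarrow> ereal" where
  "TV c f a s = (SUP n\<in>{1..}. SUP t\<in>partitions a s n.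
     ereal (\<Sum>i=1..n. max (\<bar>f (t i) - f (t (i - 1))\<bar> - c) 0))"

definition UTV :: "real \<Rightarrow> (real \<Rightarrow> real) \<Rightarrow> real \<Rightarrow> real \<Rightarrow> ereal" where
  "UTV c f a s = (SUP n\<in>{1..}. SUP t\<in>partitions a s n.
     ereal (\<Sum>i=1..n. max (f (t i) - f (t (i - 1)) - c) 0))"

definition DTV :: "real \<Rightarrow> (real \<Rightarrow> real) \<Rightarrow> real \<Rightarrow> real \<Rightarrow> ereal" where
  "DTV c f a s = (SUP n\<in>{1..}. SUP t\<in>partitions a s n.
     ereal (\<Sum>i=1..n. max (f (t (i - 1)) - f (t i) - c) 0))"


section \<open>Stopping times\<close>

text \<open>
  Times are extended reals, so that the infimum of the empty set is \<open>\<infinity>\<close>. The suprema and infima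
  of \<open>f\<close> are taken in the reals; they are over nonempty sets on which a cadlag \<open>f\<close> is bounded.
\<close>

definition drop_time :: "real \<Rightarrow> real \<Rightarrow> (real \<Rightarrow> real) \<Rightarrow> ereal \<Rightarrow> ereal" where
  "drop_time c b f u = Inf (ereal ` {s. u \<le> ereal s \<and> s \<le> b \<and>
     (SUP t\<in>{t. u \<le> ereal t \<and> t \<le> s}. f t) - f s \<ge> c})"

definition rise_time :: "real \<Rightarrow> real \<Rightarrow> (real \<Rightarrow> real) \<Rightarrow> ereal \<Rightarrow> ereal" where
  "rise_time c b f u = Inf (ereal ` {s. u \<le> ereal s \<and> s \<le> b \<and>
     f s - (INF t\<in>{t. u \<le> ereal t \<and> t \<le> s}. f t) \<ge> c})"

definition T_D :: "real \<Rightarrow> real \<Rightarrow> real \<Rightarrow> (real \<Rightarrow> real) \<Rightarrow> ereal" where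
  "T_D c a b f = drop_time c b f (ereal a)"

definition T_U :: "real \<Rightarrow> real \<Rightarrow> real \<Rightarrow> (real \<Rightarrow> real) \<Rightarrow> ereal" where
  "T_U c a b f = rise_time c b f (ereal a)"

definition next_D :: "real \<Rightarrow> real \<Rightarrow> (real \<Rightarrow> real) \<Rightarrow> ereal \<Rightarrow> ereal" where
  "next_D c b f u = (if u < ereal b then drop_time c b f u else \<infinity>)"

definition next_U :: "real \<Rightarrow> real \<Rightarrow> (real \<Rightarrow> real) \<Rightarrow> ereal \<Rightarrow> ereal" where
  "next_U c b f u = (if u < ereal b then rise_time c b f u else \<infinity>)"

primrec TU :: "real \<Rightarrow> real \<Rightarrow> real \<Rightarrow> (real \<Rightarrow> real) \<Rightarrow> nat \<Rightarrow> ereal" where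
  "TU c a b f 0 = T_U c a b f"
| "TU c a b f (Suc k) = next_U c b f (next_D c b f (TU c a b f k))"

definition TD :: "real \<Rightarrow> real \<Rightarrow> real \<Rightarrow> (real \<Rightarrow> real) \<Rightarrow> nat \<Rightarrow> ereal" where
  "TD c a b f k = next_D c b f (TU c a b f k)"

text \<open>\<open>TD_prev c a b f k\<close> is $T_{D,k-1}^c$, with $T_{D,-1}^c = a$.\<close>

definition TD_prev :: "real \<Rightarrow> real \<Rightarrow> real \<Rightarrow> (real \<Rightarrow> real) \<Rightarrow> nat \<Rightarrow> ereal" where
  "TD_prev c a b f k = (case k of 0 \<Rightarrow> ereal a | Suc j \<Rightarrow> TD c a b f j)"


section \<open>Running and total extrema\<close>

text \<open>
  \<open>m_run\<close>, \<open>m_tot\<close> are meant for \<open>TD_prev c a b f k < \<infinity>\<close> and \<open>M_run\<close>, \<open>M_tot\<close> for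
  \<open>TU c a b f k < \<infinity>\<close>; the running versions moreover only for times \<open>s\<close> in the respective
  half-open interval.
\<close>

definition m_run :: "real \<Rightarrow> real \<Rightarrow> real \<Rightarrow> (real \<Rightarrow> real) \<Rightarrow> nat \<Rightarrow> real \<Rightarrow> real" where
  "m_run c a b f k s = (INF t\<in>{t. TD_prev c a b f k \<le> ereal t \<and> t \<le> s}. f t)"

definition m_tot :: "real \<Rightarrow> real \<Rightarrow> real \<Rightarrow> (real \<Rightarrow> real) \<Rightarrow> nat \<Rightarrow> real" where
  "m_tot c a b f k =
     (INF t\<in>{t\<in>{a..b}. TD_prev c a b f k \<le> ereal t \<and> ereal t < TU c a b f k}. f t)"

definition M_run :: "real \<Rightarrow> real \<Rightarrow> real \<Rightarrow> (real \<Rightarrow> real) \<Rightarrow> nat \<Rightarrow> real \<Rightarrow> real" where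
  "M_run c a b f k s = (SUP t\<in>{t. TU c a b f k \<le> ereal t \<and> t \<le> s}. f t)"

definition M_tot :: "real \<Rightarrow> real \<Rightarrow> real \<Rightarrow> (real \<Rightarrow> real) \<Rightarrow> nat \<Rightarrow> real" where
  "M_tot c a b f k =
     (SUP t\<in>{t\<in>{a..b}. TU c a b f k \<le> ereal t \<and> ereal t < TD c a b f k}. f t)"


section \<open>The functions $f_U^c$ and $f_D^c$\<close>

definition in_up :: "real \<Rightarrow> real \<Rightarrow> real \<Rightarrow> (real \<Rightarrow> real) \<Rightarrow> real \<Rightarrow> nat \<Rightarrow> bool" where
  "in_up c a b f s k \<longleftrightarrow> TU c a b f k \<le> ereal s \<and> ereal s < TD c a b f k"

definition in_down :: "real \<Rightarrow> real \<Rightarrow> real \<Rightarrow> (real \<Rightarrow> real) \<Rightarrow> real \<Rightarrow> nat \<Rightarrow> bool" where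
  "in_down c a b f s k \<longleftrightarrow> TD c a b f k \<le> ereal s \<and> ereal s < TU c a b f (Suc k)"

text \<open>
  The formulas of the case \<open>T_D c a b f \<ge> T_U c a b f\<close>. The intervals described by \<open>in_up\<close> and
  \<open>in_down\<close> are pairwise disjoint and cover the times from \<open>TU c a b f 0\<close> up to \<open>b\<close>, so the
  index \<open>k\<close> of the interval containing \<open>s\<close> is unique.
\<close>

definition fU_base :: "real \<Rightarrow> real \<Rightarrow> real \<Rightarrow> (real \<Rightarrow> real) \<Rightarrow> real \<Rightarrow> real" where
  "fU_base c a b f s =
     (if ereal s < TU c a b f 0 then 0
      else if \<exists>k. in_up c a b f s k then
        (let k = (THE k. in_up c a b f s k) in
           (\<Sum>i<k. M_tot c a b f i - m_tot c a b f i - c)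
             + M_run c a b f k s - m_tot c a b f k - c)
      else
        (let k = (THE k. in_down c a b f s k) in
           (\<Sum>i\<le>k. M_tot c a b f i - m_tot c a b f i - c)))"

definition fD_base :: "real \<Rightarrow> real \<Rightarrow> real \<Rightarrow> (real \<Rightarrow> real) \<Rightarrow> real \<Rightarrow> real" where
  "fD_base c a b f s =
     (if ereal s < TU c a b f 0 then 0
      else if \<exists>k. in_up c a b f s k then
        (let k = (THE k. in_up c a b f s k) in
           (\<Sum>i<k. M_tot c a b f i - m_tot c a b f (Suc i) - c))
      else
        (let k = (THE k. in_down c a b f s k) in
           (\<Sum>i<k. M_tot c a b f i - m_tot c a b f (Suc i) - c)
             + M_tot c a b f k - m_run c a b f (Suc k) s - c))"

definition f_U :: "real \<Rightarrow> real \<Rightarrow> real \<Rightarrow> (real \<Rightarrow> real) \<Rightarrow> real \<Rightarrow> real" where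
  "f_U c a b f s =
     (if T_D c a b f \<ge> T_U c a b f then fU_base c a b f s else fD_base c a b (\<lambda>x. - f x) s)"

definition f_D :: "real \<Rightarrow> real \<Rightarrow> real \<Rightarrow> (real \<Rightarrow> real) \<Rightarrow> real \<Rightarrow> real" where
  "f_D c a b f s =
     (if T_D c a b f \<ge> T_U c a b f then fD_base c a b f s else fU_base c a b (\<lambda>x. - f x) s)"

end

theory Submission
  imports Defs
begin

text \<open>
  Let $f$ rise by $c$ before it drops by $c$; the other case follows by passing to $-f$. With
  $m_0$ the infimum of $f$ on the initial phase, the function $h = m_0 + c/2 + f_U^c - f_D^c$ is the
  running maximum minus $c/2$ on upward phases and the running minimum plus $c/2$ on downward
  phases, so $|f - h| \le c/2$. Moreover $f_U^c$ and $f_D^c$ are nondecreasing. Hence for $x \le y$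
  the truncated increment $\max\{f(y) - f(x) - c, 0\}$ is at most $f_U^c(y) - f_U^c(x)$, and
  symmetrically for decrements and $f_D^c$; summing over a partition gives $UTV^c \le f_U^c$ and
  $DTV^c \le f_D^c$. Conversely, partitions through points where $f$ nearly attains the successive
  phase extrema show $TV^c \ge f_U^c + f_D^c$. Since $TV^c \le UTV^c + DTV^c$, all three
  inequalities are equalities.
\<close>

section \<open>Symmetry under negation, boundedness, and comparison of the variations\<close>

lemma INF_uminus_real:
  fixes f :: "'a \<Rightarrow> real"
  shows "(INF t\<in>S. - f t) = - (SUP t\<in>S. f t)" and "(SUP t\<in>S. - f t) = - (INF t\<in>S. f t)"
  \<comment> \<open>On the reals \<open>Inf\<close> is defined as the negated \<open>Sup\<close> of
    the negated set, so both identities hold for every \<open>S\<close>.\<close>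
  by (simp_all add: Inf_real_def image_image)

lemma Collect_between: "{t. u \<le> t \<and> t \<le> s} = {u..s}" for u s :: real
  by auto

lemma ereal_less_mono_left: "x \<le> y \<Longrightarrow> ereal y < z \<Longrightarrow> ereal x < z"
  by (metis ereal_less_eq(3) le_less_trans)

lemma drop_time_uminus: "drop_time c b (\<lambda>x. - f x) u = rise_time c b f u"
  and rise_time_uminus: "rise_time c b (\<lambda>x. - f x) u = drop_time c b f u"
  by (simp_all add: drop_time_def rise_time_def INF_uminus_real algebra_simps)

lemma next_U_uminus: "next_U c b (\<lambda>x. - f x) u = next_D c b f u"
  by (simp add: next_U_def next_D_def rise_time_uminus)

lemma cadlag_on_uminus: "cadlag_on a b f \<Longrightarrow> cadlag_on a b (\<lambda>x. - f x)"
  unfolding cadlag_on_def by (blast intro: tendsto_minus)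

lemma UTV_uminus: "UTV c (\<lambda>x. - f x) a s = DTV c f a s"
  and DTV_uminus: "DTV c (\<lambda>x. - f x) a s = UTV c f a s"
  and TV_uminus: "TV c (\<lambda>x. - f x) a s = TV c f a s"
  by (simp_all add: UTV_def DTV_def TV_def abs_minus_commute)

text \<open>One-sided limits bound \<open>f\<close> near every point, and bisection turns local
  bounds into a global one.\<close>

lemma cadlag_bounded:
  assumes "cadlag_on a b f"
  shows "\<exists>B. \<forall>t\<in>{a..b}. \<bar>f t\<bar> \<le> B"
proof (cases "a \<le> b")
  case True
  \<comment> \<open>Bisection asks about small intervals around a point, which may stick out of
    \<open>{a..b}\<close>; hence the intersection.\<close>
  define P where "P u v \<longleftrightarrow> (\<exists>B. \<forall>t\<in>{u..v}\<inter>{a..b}. \<bar>f t\<bar> \<le> B)" for u v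
  from True have "P a b"
  proof (induction rule: Bolzano)
    case (trans u v w)
    then obtain B B' where B: "\<forall>t\<in>{u..v}\<inter>{a..b}. \<bar>f t\<bar> \<le> B" "\<forall>t\<in>{v..w}\<inter>{a..b}. \<bar>f t\<bar> \<le> B'"
      unfolding P_def by blast
    have "\<bar>f t\<bar> \<le> max B B'" if "t \<in> {u..w}\<inter>{a..b}" for t
      using that B(1)[rule_format, of t] B(2)[rule_format, of t] by (cases "t \<le> v") auto
    then show ?case unfolding P_def by blast
  next
    case (local x)
    have "\<exists>r>x. \<exists>B. \<forall>t. x < t \<and> t < r \<and> t \<le> b \<longrightarrow> \<bar>f t\<bar> \<le> B"
    proof (cases "x < b")
      case True
      then have "(f \<longlongrightarrow> f x) (at_right x)" using assms local by (auto simp: cadlag_on_def)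
      then have "eventually (\<lambda>t. dist (f t) (f x) < 1) (at_right x)" by (rule tendstoD) simp
      then obtain r where "r > x" and r: "\<And>t. x < t \<Longrightarrow> t < r \<Longrightarrow> \<bar>f t - f x\<bar> < 1"
        unfolding eventually_at_right_field dist_real_def by blast
      moreover have "\<bar>f t\<bar> \<le> \<bar>f x\<bar> + 1" if "x < t" "t < r" for t
        using r[OF that] by linarith
      ultimately show ?thesis by blast
    next
      case False
      then show ?thesis by (intro exI[of _ "x + 1"]) auto
    qed
    then obtain r B where r: "r > x" "\<And>t. x < t \<Longrightarrow> t < r \<Longrightarrow> t \<le> b \<Longrightarrow> \<bar>f t\<bar> \<le> B" by blast
    have "\<exists>l<x. \<exists>B. \<forall>t. l < t \<and> t < x \<and> a \<le> t \<longrightarrow> \<bar>f t\<bar> \<le> B"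
    proof (cases "a < x")
      case True
      then obtain y where "(f \<longlongrightarrow> y) (at_left x)"
        using assms local unfolding cadlag_on_def by (meson greaterThanAtMost_iff)
      then have "eventually (\<lambda>t. dist (f t) y < 1) (at_left x)" by (rule tendstoD) simp
      then obtain l where "l < x" and l: "\<And>t. l < t \<Longrightarrow> t < x \<Longrightarrow> \<bar>f t - y\<bar> < 1"
        unfolding eventually_at_left_field dist_real_def by blast
      moreover have "\<bar>f t\<bar> \<le> \<bar>y\<bar> + 1" if "l < t" "t < x" for t
        using l[OF that] by linarith
      ultimately show ?thesis by blast
    next
      case False
      then show ?thesis by (intro exI[of _ "x - 1"]) auto
    qed
    then obtain l B' where l: "l < x" "\<And>t. l < t \<Longrightarrow> t < x \<Longrightarrow> a \<le> t \<Longrightarrow> \<bar>f t\<bar> \<le> B'" by blast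
    show ?case
    proof (intro exI[of _ "min (r - x) (x - l)"] conjI allI impI)
      show "0 < min (r - x) (x - l)" using r l by simp
      fix u v assume uv: "u \<le> x \<and> x \<le> v \<and> v - u < min (r - x) (x - l)"
      have "\<bar>f t\<bar> \<le> max \<bar>f x\<bar> (max B B')" if "t \<in> {u..v}\<inter>{a..b}" for t
        using that uv r(2)[of t] l(2)[of t] by (cases t x rule: linorder_cases) auto
      then show "P u v" unfolding P_def by blast
    qed
  qed
  then show ?thesis by (simp add: P_def)
qed auto

text \<open>For \<open>c \<ge> 0\<close> an increment cannot exceed \<open>c\<close> in both
  directions, so each term of \<open>TV\<close> is the sum of the corresponding up and down
  terms.\<close>

lemma TV_le_UTV_plus_DTV:
  assumes "c \<ge> 0"
  shows "TV c f a s \<le> UTV c f a s + DTV c f a s"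
  unfolding TV_def
proof (intro SUP_least)
  fix n t assume n: "n \<in> {1::nat..}" and t: "t \<in> partitions a s n"
  have "(\<Sum>i=1..n. max (\<bar>f (t i) - f (t (i - 1))\<bar> - c) 0) =
      (\<Sum>i=1..n. max (f (t i) - f (t (i - 1)) - c) 0 + max (f (t (i - 1)) - f (t i) - c) 0)"
    using assms by (intro sum.cong) (auto simp: max_def abs_if)
  then have "ereal (\<Sum>i=1..n. max (\<bar>f (t i) - f (t (i - 1))\<bar> - c) 0) =
      ereal (\<Sum>i=1..n. max (f (t i) - f (t (i - 1)) - c) 0) +
      ereal (\<Sum>i=1..n. max (f (t (i - 1)) - f (t i) - c) 0)"
    by (simp add: sum.distrib)
  also have "\<dots> \<le> UTV c f a s + DTV c f a s"
    unfolding UTV_def DTV_def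
    by (intro add_mono SUP_upper2[OF n] SUP_upper2[OF t] order_refl)
  finally show "ereal (\<Sum>i=1..n. max (\<bar>f (t i) - f (t (i - 1))\<bar> - c) 0) \<le> UTV c f a s + DTV c f a s" .
qed

section \<open>Near-extremal points and a single rise or drop time\<close>

locale cadlag_fun =
  fixes a b c :: real and f :: "real \<Rightarrow> real"
  assumes a_less_b: "a < b" and c_pos: "c > 0" and cadlag: "cadlag_on a b f"
begin

lemma bdd: "S \<subseteq> {a..b} \<Longrightarrow> bdd_above (f ` S)" "S \<subseteq> {a..b} \<Longrightarrow> bdd_below (f ` S)"
proof -
  obtain B where B: "\<forall>t\<in>{a..b}. \<bar>f t\<bar> \<le> B" using cadlag_bounded[OF cadlag] by blast
  then have "f t \<le> B" "- B \<le> f t" if "t \<in> {a..b}" for t using that by (force simp: abs_le_iff)+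
  then show "S \<subseteq> {a..b} \<Longrightarrow> bdd_above (f ` S)" "S \<subseteq> {a..b} \<Longrightarrow> bdd_below (f ` S)"
    by (meson bdd_aboveI2 bdd_belowI2 subset_eq)+
qed

lemma INF_le: "S \<subseteq> {a..b} \<Longrightarrow> t \<in> S \<Longrightarrow> Inf (f ` S) \<le> f t"
  and le_SUP: "S \<subseteq> {a..b} \<Longrightarrow> t \<in> S \<Longrightarrow> f t \<le> Sup (f ` S)"
  by (auto intro: cINF_lower cSUP_upper bdd)

lemma INF_antimono: "S \<subseteq> T \<Longrightarrow> T \<subseteq> {a..b} \<Longrightarrow> S \<noteq> {} \<Longrightarrow> Inf (f ` T) \<le> Inf (f ` S)"
  and SUP_mono_set: "S \<subseteq> T \<Longrightarrow> T \<subseteq> {a..b} \<Longrightarrow> S \<noteq> {} \<Longrightarrow> Sup (f ` S) \<le> Sup (f ` T)"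
  by (auto intro!: cINF_superset_mono cSUP_subset_mono bdd)

lemma ex_near_INF: "S \<noteq> {} \<Longrightarrow> e > 0 \<Longrightarrow> \<exists>t\<in>S. f t < Inf (f ` S) + e"
  and ex_near_SUP: "S \<noteq> {} \<Longrightarrow> e > 0 \<Longrightarrow> \<exists>t\<in>S. f t > Sup (f ` S) - e"
proof -
  assume S: "S \<noteq> {}" and e: "e > 0"
  show "\<exists>t\<in>S. f t < Inf (f ` S) + e"
    by (rule ccontr) (use S e cINF_greatest[of S "Inf (f ` S) + e" f] in force)
  show "\<exists>t\<in>S. f t > Sup (f ` S) - e"
    by (rule ccontr) (use S e cSUP_least[of S f "Sup (f ` S) - e"] in force)
qed

text \<open>Right-continuity makes the infimum a minimum. It exceeds \<open>u\<close> because on the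
  single point \<open>u\<close> the rise is 0, below \<open>c\<close>.\<close>

lemma rise_time_attained:
  assumes u: "a \<le> u" "u \<le> b"
  shows "rise_time c b f (ereal u) = \<infinity> \<or>
    (\<exists>d. rise_time c b f (ereal u) = ereal d \<and> u < d \<and> d \<le> b \<and> Inf (f ` {u..d}) \<le> f d - c)"
proof -
  define S where "S = {s. u \<le> s \<and> s \<le> b \<and> f s - Inf (f ` {u..s}) \<ge> c}"
  have S: "rise_time c b f (ereal u) = Inf (ereal ` S)"
    unfolding rise_time_def S_def by (simp add: Collect_between)
  show ?thesis
  proof (cases "S = {}")
    case True
    then show ?thesis using S by (simp add: top_ereal_def)
  next
    case False
    define d where "d = Inf S"
    have bS: "bdd_below S" by (auto simp: S_def intro: bdd_belowI)
    have eq: "rise_time c b f (ereal u) = ereal d"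
      using S False bS by (simp add: d_def ereal_Inf')
    have ud: "u \<le> d" unfolding d_def using False by (intro cInf_greatest) (auto simp: S_def)
    have dle: "d \<le> s" if "s \<in> S" for s unfolding d_def using that bS by (rule cInf_lower)
    have db: "d \<le> b" using False dle by (fastforce simp: S_def)
    have att: "Inf (f ` {u..d}) \<le> f d - c"
    proof (rule ccontr)
      assume neg: "\<not> ?thesis"
      then have dS: "d \<notin> S" by (auto simp: S_def)
      \<comment> \<open>Some point of \<open>S\<close> lies strictly after \<open>d\<close>, so
        \<open>d\<close> is a point where right-continuity is available.\<close>
      then have "d < b" using False dle db by (force simp: S_def order_less_le)
      then have lim: "(f \<longlongrightarrow> f d) (at_right d)" using cadlag ud u by (auto simp: cadlag_on_def)
      \<comment> \<open>Just after \<open>d\<close>, \<open>f\<close> stays within \<open>e\<close>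
        of \<open>f d\<close>. If the infimum up to \<open>s\<close> is only known to be at least
        \<open>f d - e\<close>, the bound \<open>c / 2\<close> keeps the rise below
        \<open>c\<close>; if it is at least the infimum up to \<open>d\<close>, half of the missing
        rise does.\<close>
      define e where "e = min (c / 2) ((c - (f d - Inf (f ` {u..d}))) / 2)"
      have e: "e > 0" using neg c_pos by (simp add: e_def)
      obtain r where r: "r > d" "\<And>t. d < t \<Longrightarrow> t < r \<Longrightarrow> \<bar>f t - f d\<bar> < e"
        using tendstoD[OF lim e] by (auto simp: eventually_at_right_field dist_real_def)
      obtain s where s: "s \<in> S" "s < r"
        using cInf_lessD[OF False, of r] r by (auto simp: d_def)
      then have ds: "d < s" using dle dS by (metis order_less_le)
      have "min (Inf (f ` {u..d})) (f d - e) \<le> Inf (f ` {u..s})"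
      proof (rule cINF_greatest)
        show "{u..s} \<noteq> {}" using ud ds by auto
        fix t assume t: "t \<in> {u..s}"
        show "min (Inf (f ` {u..d})) (f d - e) \<le> f t"
        proof (cases "t \<le> d")
          case True
          then have "Inf (f ` {u..d}) \<le> f t" using t u db by (intro INF_le) auto
          then show ?thesis by simp
        next
          case False
          then show ?thesis using r(2)[of t] t s by auto
        qed
      qed
      moreover have "f s < f d + e" using r(2)[of s] ds s by auto
      moreover have "c \<le> f s - Inf (f ` {u..s})" using s by (simp add: S_def)
      moreover have "e \<le> c / 2" "e \<le> (c - (f d - Inf (f ` {u..d}))) / 2"
        by (simp_all only: e_def min.cobounded1 min.cobounded2)
      ultimately show False using e by (auto simp: min_def split: if_splits)
    qed
    have "u \<noteq> d" using att c_pos by auto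
    then show ?thesis using eq ud db att by auto
  qed
qed

text \<open>Passes to the half-open interval over which \<open>m_tot\<close> takes its infimum:
  \<open>f d\<close> lies at least \<open>c\<close> above the infimum, so \<open>d\<close> does not
  contribute to it.\<close>

lemma next_U_step:
  assumes u: "a \<le> u" "u \<le> b"
  obtains (infinite) "next_U c b f (ereal u) = \<infinity>"
  | (finite) d where "next_U c b f (ereal u) = ereal d" "u < d" "d \<le> b" "Inf (f ` {u..<d}) \<le> f d - c"
proof -
  consider "next_U c b f (ereal u) = \<infinity>" | d where "next_U c b f (ereal u) = ereal d" "u < d" "d \<le> b"
    "Inf (f ` {u..d}) \<le> f d - c"
    using rise_time_attained[OF u] by (auto simp: next_U_def)
  then show thesis
  proof cases
    case (2 d)
    have "Inf (f ` {u..<d}) \<le> f d - c + e" if e: "e > 0" for e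
    proof -
      \<comment> \<open>The \<open>c\<close> in \<open>min e c\<close> forces
        \<open>f t < f d\<close>, hence \<open>t \<noteq> d\<close>.\<close>
      obtain t where t: "t \<in> {u..d}" "f t < Inf (f ` {u..d}) + min e c"
        using ex_near_INF[of "{u..d}" "min e c"] e c_pos 2 by auto
      have "t \<noteq> d" using t 2 by auto
      then have "Inf (f ` {u..<d}) \<le> f t" using t u 2 by (intro INF_le) auto
      then show ?thesis using t 2 by auto
    qed
    then show ?thesis using finite 2 by (meson field_le_epsilon)
  qed (use infinite in auto)
qed

text \<open>A rise of \<open>c\<close> within \<open>[u, t]\<close> would put \<open>t\<close> into
  the set whose infimum is the rise time.\<close>

lemma rise_less:
  assumes u: "a \<le> u" and t: "t \<le> b" "ereal t < next_U c b f (ereal u)" and x: "u \<le> x" "x \<le> t"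
  shows "f t - f x < c"
proof (cases "u < b")
  case True
  have "f t - Inf (f ` {u..t}) < c"
  proof (rule ccontr)
    assume "\<not> ?thesis"
    then have "rise_time c b f (ereal u) \<le> ereal t"
      unfolding rise_time_def using t x by (intro Inf_lower imageI) (auto simp: Collect_between)
    then show False using t True by (simp add: next_U_def)
  qed
  moreover have "Inf (f ` {u..t}) \<le> f x" using u t x by (intro INF_le) auto
  ultimately show ?thesis by simp
next
  case False
  \<comment> \<open>For \<open>u \<ge> b\<close>, \<open>next_U\<close> is infinite by convention
    and says nothing about \<open>f\<close>, but only a single point remains.\<close>
  then have "t = x" using t x by auto
  then show ?thesis using c_pos by simp
qed

lemma cadlag_fun_uminus: "cadlag_fun a b c (\<lambda>x. - f x)"
  using a_less_b c_pos cadlag by (simp add: cadlag_fun_def cadlag_on_uminus)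

lemma next_D_step:
  assumes u: "a \<le> u" "u \<le> b"
  obtains (infinite) "next_D c b f (ereal u) = \<infinity>"
  | (finite) d where "next_D c b f (ereal u) = ereal d" "u < d" "d \<le> b" "f d + c \<le> Sup (f ` {u..<d})"
proof (rule cadlag_fun.next_U_step[OF cadlag_fun_uminus u, unfolded next_U_uminus INF_uminus_real])
  fix d
  assume "next_D c b f (ereal u) = ereal d" "u < d" "d \<le> b" "- Sup (f ` {u..<d}) \<le> - f d - c"
  then show thesis by (intro finite) auto
qed (rule infinite)

lemma drop_less:
  assumes "a \<le> u" "t \<le> b" "ereal t < next_D c b f (ereal u)" "u \<le> x" "x \<le> t"
  shows "f x - f t < c"
  using cadlag_fun.rise_less[OF cadlag_fun_uminus, unfolded next_U_uminus, OF assms] by simp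

end

text \<open>The sum telescopes to \<open>F (t n) - F (t 0)\<close>; monotonicity and
  \<open>F a = 0\<close> take care of the stretches before \<open>t 0\<close> and after
  \<open>t n\<close>.\<close>

lemma partition_sum_le:
  fixes F :: "real \<Rightarrow> real" and g :: "real \<Rightarrow> real \<Rightarrow> real"
  assumes t: "t \<in> partitions a s n"
    and g: "\<And>x y. a \<le> x \<Longrightarrow> x \<le> y \<Longrightarrow> y \<le> s \<Longrightarrow> g x y \<le> F y - F x"
    and F: "\<And>x y. a \<le> x \<Longrightarrow> x \<le> y \<Longrightarrow> y \<le> s \<Longrightarrow> F x \<le> F y" and zero: "F a = 0"
  shows "(\<Sum>i=1..n. g (t (i - 1)) (t i)) \<le> F s"
proof -
  have less: "t i < t (Suc i)" if "i < n" for i using t that by (simp add: partitions_def)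
  have le: "t i \<le> t j" if "i \<le> j" "j \<le> n" for i j
    using that
  proof (induction j)
    case (Suc j)
    then show ?case using less[of j] by (cases "i = Suc j") auto
  qed simp
  have ends: "a \<le> t 0" "t n \<le> s" using t by (auto simp: partitions_def)
  have in_range: "a \<le> t i" "t i \<le> s" if "i \<le> n" for i
    using le[of 0 i] le[of i n] ends that by auto
  have "(\<Sum>i=1..j. g (t (i - 1)) (t i)) \<le> F (t j) - F (t 0)" if "j \<le> n" for j
    using that
  proof (induction j)
    case (Suc j)
    then have "g (t j) (t (Suc j)) \<le> F (t (Suc j)) - F (t j)"
      using less[of j] in_range by (intro g) auto
    then show ?case using Suc by simp
  qed simp
  from this[of n] have "(\<Sum>i=1..n. g (t (i - 1)) (t i)) \<le> F (t n) - F (t 0)" by simp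
  moreover have "F (t n) \<le> F s" "F a \<le> F (t 0)"
    using ends in_range[of n] in_range[of 0] by (auto intro: F)
  ultimately show ?thesis using zero by simp
qed

section \<open>The alternating phases when the rise comes first\<close>

locale rise_first = cadlag_fun +
  assumes rise_first: "T_U c a b f \<le> T_D c a b f"
begin

declare TU.simps [simp del]

abbreviation U where "U \<equiv> TU c a b f"
abbreviation D where "D \<equiv> TD c a b f"
abbreviation P where "P \<equiv> TD_prev c a b f"
abbreviation m where "m \<equiv> m_tot c a b f"
abbreviation M where "M \<equiv> M_tot c a b f"

text \<open>Contributions of completed phases: \<open>fU\<close> stays at \<open>A (Suc k)\<close>
  on the \<open>k\<close>-th downward phase, and \<open>fD\<close> at \<open>B k\<close> on the
  \<open>k\<close>-th upward phase.\<close>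

definition A :: "nat \<Rightarrow> real" where "A k = (\<Sum>i<k. M i - m i - c)"
definition B :: "nat \<Rightarrow> real" where "B k = (\<Sum>i<k. M i - m (Suc i) - c)"

lemma P_0: "P 0 = ereal a" and P_Suc: "P (Suc k) = D k"
  by (simp_all add: TD_prev_def)

text \<open>Treats the first rise time like the later ones, with \<open>P 0 = a\<close>;
  \<open>a < b\<close> keeps \<open>next_U\<close> off its default branch.\<close>

lemma U_eq: "U k = next_U c b f (P k)"
  using a_less_b by (cases k) (simp_all add: TU.simps TD_prev_def TD_def next_U_def T_U_def)

lemma D_eq: "D k = next_D c b f (U k)"
  by (simp add: TD_def)

lemma next_infinity: "next_U c b f \<infinity> = \<infinity>" "next_D c b f \<infinity> = \<infinity>"
  by (simp_all add: next_U_def next_D_def)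

lemma P_cases: "P k = \<infinity> \<or> (\<exists>p. P k = ereal p \<and> a \<le> p \<and> p \<le> b)"
  and U_cases: "U k = \<infinity> \<or> (\<exists>u. U k = ereal u \<and> a \<le> u \<and> u \<le> b)"
proof -
  have U: "U k = \<infinity> \<or> (\<exists>u. U k = ereal u \<and> a \<le> u \<and> u \<le> b)"
    if "P k = \<infinity> \<or> (\<exists>p. P k = ereal p \<and> a \<le> p \<and> p \<le> b)" for k
    using that
  proof (elim disjE exE conjE)
    fix p assume p: "P k = ereal p" "a \<le> p" "p \<le> b"
    show ?thesis
      by (rule next_U_step[OF p(2,3)]) (use p in \<open>auto simp: U_eq\<close>)
  qed (simp add: U_eq next_infinity)
  have P: "P k = \<infinity> \<or> (\<exists>p. P k = ereal p \<and> a \<le> p \<and> p \<le> b)" for k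
  proof (induction k)
    case 0
    then show ?case using a_less_b by (simp add: P_0)
  next
    case (Suc k)
    from U[OF this] show ?case
    proof (elim disjE exE conjE)
      fix p assume p: "U k = ereal p" "a \<le> p" "p \<le> b"
      show ?thesis
        by (rule next_D_step[OF p(2,3)]) (use p in \<open>auto simp: P_Suc D_eq\<close>)
    qed (simp add: P_Suc D_eq next_infinity)
  qed
  show "P k = \<infinity> \<or> (\<exists>p. P k = ereal p \<and> a \<le> p \<and> p \<le> b)" by (rule P)
  show "U k = \<infinity> \<or> (\<exists>u. U k = ereal u \<and> a \<le> u \<and> u \<le> b)" by (rule U[OF P])
qed

lemma U_finite:
  assumes "U k = ereal u"
  obtains p where "P k = ereal p" "a \<le> p" "p < u" "u \<le> b" "m k = Inf (f ` {p..<u})" "m k \<le> f u - c"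
proof -
  obtain p where p: "P k = ereal p" "a \<le> p" "p \<le> b"
    using P_cases[of k] assms by (auto simp: U_eq next_infinity)
  show ?thesis
  proof (rule next_U_step[OF p(2,3)])
    fix d assume d: "next_U c b f (ereal p) = ereal d" "p < d" "d \<le> b" "Inf (f ` {p..<d}) \<le> f d - c"
    have [simp]: "d = u" using d assms p by (simp add: U_eq)
    have "{t \<in> {a..b}. P k \<le> ereal t \<and> ereal t < U k} = {p..<u}" using p d assms by auto
    then have "m k = Inf (f ` {p..<u})" by (simp only: m_tot_def)
    then show thesis using that p d by simp
  qed (use p assms in \<open>simp add: U_eq\<close>)
qed

lemma D_finite:
  assumes "D k = ereal d"
  obtains u where "U k = ereal u" "a \<le> u" "u < d" "d \<le> b" "M k = Sup (f ` {u..<d})" "f d + c \<le> M k"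
proof -
  obtain u where u: "U k = ereal u" "a \<le> u" "u \<le> b"
    using U_cases[of k] assms by (auto simp: D_eq next_infinity)
  show ?thesis
  proof (rule next_D_step[OF u(2,3)])
    fix e assume e: "next_D c b f (ereal u) = ereal e" "u < e" "e \<le> b" "f e + c \<le> Sup (f ` {u..<e})"
    have [simp]: "e = d" using e assms u by (simp add: D_eq)
    have "{t \<in> {a..b}. U k \<le> ereal t \<and> ereal t < D k} = {u..<d}" using u e assms by auto
    then have "M k = Sup (f ` {u..<d})" by (simp only: M_tot_def)
    then show thesis using that u e by simp
  qed (use u assms in \<open>simp add: D_eq\<close>)
qed

lemma P_less_U:
  assumes "P k \<noteq> \<infinity>"
  shows "P k < U k"
proof (cases "U k = \<infinity>")
  case True
  then show ?thesis using P_cases[of k] assms by auto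
next
  case False
  then obtain u where u: "U k = ereal u" using U_cases by blast
  show ?thesis by (rule U_finite[OF u]) (simp add: u)
qed

lemma U_less_D:
  assumes "U k \<noteq> \<infinity>"
  shows "U k < D k"
proof (cases "D k = \<infinity>")
  case True
  then show ?thesis using U_cases[of k] assms by auto
next
  case False
  then obtain d where d: "D k = ereal d" using P_cases[of "Suc k"] by (auto simp: P_Suc)
  show ?thesis by (rule D_finite[OF d]) (simp add: d)
qed

lemma D_less_U_Suc: "D k \<noteq> \<infinity> \<Longrightarrow> D k < U (Suc k)"
  using P_less_U[of "Suc k"] by (simp add: P_Suc)

text \<open>The strict order breaks down once times are infinite; the weak order holds for all
  indices and gives monotonicity of the whole sequence.\<close>

lemma U_le_D: "U k \<le> D k"
  using U_less_D[of k] by (cases "U k = \<infinity>") (auto simp: D_eq next_infinity)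

lemma D_le_U_Suc: "D k \<le> U (Suc k)"
  using D_less_U_Suc[of k] by (cases "D k = \<infinity>") (auto simp: U_eq P_Suc next_infinity)

lemma U_mono: "k \<le> j \<Longrightarrow> U k \<le> U j"
  by (rule lift_Suc_mono_le) (rule order_trans[OF U_le_D D_le_U_Suc])

lemma D_le_U: "k < j \<Longrightarrow> D k \<le> U j"
  using U_mono[of "Suc k" j] D_le_U_Suc[of k] by simp

lemma a_less_U: "ereal a < U 0"
  using P_less_U[of 0] by (simp add: P_0)

lemma U_0_le: "U 0 \<le> U k"
  by (rule U_mono) simp

text \<open>Two upward phases are separated by a drop time. Uniqueness serves to evaluate the
  \<open>THE\<close> in \<open>fU_base\<close> and \<open>fD_base\<close>.\<close>

lemma in_up_unique:
  assumes "in_up c a b f s k" "in_up c a b f s j"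
  shows "k = j"
proof (rule ccontr)
  assume "k \<noteq> j"
  then have "D k \<le> U j \<or> D j \<le> U k" using D_le_U by (metis linorder_neqE_nat)
  then show False using assms by (auto simp: in_up_def)
qed

lemma in_down_unique:
  assumes "in_down c a b f s k" "in_down c a b f s j"
  shows "k = j"
proof (rule ccontr)
  assume "k \<noteq> j"
  then have "U (Suc k) \<le> D j \<or> U (Suc j) \<le> D k"
    using U_mono U_le_D by (metis Suc_leI linorder_neqE_nat order_trans)
  then show False using assms by (auto simp: in_down_def)
qed

text \<open>Ensures that on a downward phase \<open>fU_base\<close> and \<open>fD_base\<close> reach
  their last branch.\<close>

lemma in_up_not_in_down:
  assumes "in_up c a b f s k"
  shows "\<not> in_down c a b f s j"
proof
  assume down: "in_down c a b f s j"
  have "D k \<le> D j \<or> U (Suc j) \<le> U k"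
  proof (cases "k \<le> j")
    case True
    then show ?thesis using D_le_U[of k j] U_le_D[of j] by (cases "k = j") auto
  next
    case False
    then show ?thesis using U_mono[of "Suc j" k] by simp
  qed
  then show False using assms down by (auto simp: in_up_def in_down_def)
qed

section \<open>Explicit values of \<open>fU\<close> and \<open>fD\<close> on each phase\<close>

abbreviation fU where "fU \<equiv> fU_base c a b f"
abbreviation fD where "fD \<equiv> fD_base c a b f"

lemma values_initial: "ereal s < U 0 \<Longrightarrow> fU s = 0" "ereal s < U 0 \<Longrightarrow> fD s = 0"
  by (simp_all add: fU_base_def fD_base_def)

lemma values_up:
  assumes u: "U k = ereal u" and s: "u \<le> s" "ereal s < D k"
  shows "fU s = A k + Sup (f ` {u..s}) - m k - c" "fD s = B k"
proof -
  have up: "in_up c a b f s k" using assms by (simp add: in_up_def)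
  then have the: "(THE k. in_up c a b f s k) = k" using in_up_unique by blast
  have ex: "\<exists>k. in_up c a b f s k" using up by blast
  have "U 0 \<le> ereal s" using U_0_le[of k] u s by (simp add: order_trans)
  then have ge: "\<not> ereal s < U 0" by simp
  have run: "M_run c a b f k s = Sup (f ` {u..s})" by (simp add: M_run_def u Collect_between)
  show "fU s = A k + Sup (f ` {u..s}) - m k - c"
    unfolding fU_base_def Let_def the run A_def by (simp only: ge ex if_True if_False)
  show "fD s = B k"
    unfolding fD_base_def Let_def the B_def by (simp only: ge ex if_True if_False)
qed

lemma values_down:
  assumes d: "D k = ereal d" and s: "d \<le> s" "ereal s < U (Suc k)"
  shows "fU s = A (Suc k)" "fD s = B k + M k - Inf (f ` {d..s}) - c"
proof -
  have down: "in_down c a b f s k" using assms by (simp add: in_down_def)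
  then have the: "(THE k. in_down c a b f s k) = k" using in_down_unique by blast
  have nex: "\<not> (\<exists>k. in_up c a b f s k)" using down in_up_not_in_down by blast
  have "U 0 \<le> D k" using U_0_le[of k] U_le_D[of k] by (rule order_trans)
  also have "D k \<le> ereal s" using d s by simp
  finally have ge: "\<not> ereal s < U 0" by simp
  have run: "m_run c a b f (Suc k) s = Inf (f ` {d..s})"
    by (simp add: m_run_def P_Suc d Collect_between)
  show "fU s = A (Suc k)"
    unfolding fU_base_def Let_def the A_def lessThan_Suc_atMost
    by (simp only: ge nex if_False)
  show "fD s = B k + M k - Inf (f ` {d..s}) - c"
    unfolding fD_base_def Let_def the run B_def by (simp only: ge nex if_False)
qed

text \<open>Infinitely many phases would accumulate at a point where \<open>f\<close> has no left limit.\<close>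

lemma ex_less_U:
  assumes "s \<le> b"
  shows "\<exists>k. ereal s < U k"
proof (rule ccontr)
  assume "\<not> ?thesis"
  then have U_le: "U k \<le> ereal s" for k by (simp add: not_less)
  have "\<exists>u. U k = ereal u \<and> a \<le> u \<and> u \<le> b" for k
    using U_cases[of k] U_le[of k] by auto
  then obtain u where u: "\<And>k. U k = ereal (u k)" "\<And>k. a \<le> u k" "\<And>k. u k \<le> b" by metis
  have "\<exists>d. D k = ereal d" for k
    using P_cases[of "Suc k"] D_le_U_Suc[of k] u(1)[of "Suc k"] by (auto simp: P_Suc)
  then obtain d where d: "\<And>k. D k = ereal (d k)" by metis
  have ud: "u k < d k" for k using U_less_D[of k] by (simp add: d u(1))
  have du: "d k < u (Suc k)" for k using D_less_U_Suc[of k] by (simp add: d u(1))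
  define L where "L = (SUP k. u k)"
  have bu: "bdd_above (range u)" by (rule bdd_aboveI2[where M = b]) (rule u(3))
  have le_L: "u k \<le> L" for k unfolding L_def using bu by (intro cSUP_upper) auto
  have dL: "d k < L" for k using du[of k] le_L[of "Suc k"] by linarith
  have uL: "u k < L" for k using ud[of k] dL[of k] by linarith
  have "a < L" using uL[of 0] u(2)[of 0] by simp
  moreover have "L \<le> b" unfolding L_def using u(3) by (intro cSUP_least) auto
  ultimately obtain l where "(f \<longlongrightarrow> l) (at_left L)"
    using cadlag unfolding cadlag_on_def by (meson greaterThanAtMost_iff)
  \<comment> \<open>Values just left of \<open>L\<close> then differ by less than
    \<open>2 * c / 3\<close>, whereas each upward phase contains a \<open>t\<close> with
    \<open>f t > f (d k) + 2 * c / 3\<close>.\<close>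
  then have "eventually (\<lambda>t. dist (f t) l < c / 3) (at_left L)"
    using c_pos by (intro tendstoD) auto
  then obtain r where r: "r < L" "\<And>t. r < t \<Longrightarrow> t < L \<Longrightarrow> \<bar>f t - l\<bar> < c / 3"
    unfolding eventually_at_left_field dist_real_def by blast
  obtain k where k: "r < u k"
    using r(1) less_cSUP_iff[OF _ bu] by (auto simp: L_def)
  have M: "M k = Sup (f ` {u k..<d k})" "f (d k) + c \<le> M k"
    by (rule D_finite[OF d[of k]], simp add: u(1))+
  obtain t where t: "t \<in> {u k..<d k}" "M k - c / 3 < f t"
    using ex_near_SUP[of "{u k..<d k}" "c / 3"] ud[of k] c_pos M by auto
  have "\<bar>f t - l\<bar> < c / 3" using r(2)[of t] t k dL[of k] by auto
  moreover have "\<bar>f (d k) - l\<bar> < c / 3" using r(2)[of "d k"] k dL[of k] ud[of k] by auto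
  ultimately show False using t M by linarith
qed

lemma phase_cases:
  assumes "s \<le> b"
  obtains (initial) "ereal s < U 0"
  | (up) k u where "U k = ereal u" "a \<le> u" "u \<le> s" "ereal s < D k"
  | (down) k d where "D k = ereal d" "a \<le> d" "d \<le> s" "ereal s < U (Suc k)"
proof -
  show thesis
  proof (cases "ereal s < U 0")
    case False
    \<comment> \<open>\<open>j\<close> comes just before the first index whose rise time exceeds
      \<open>s\<close>; comparing \<open>s\<close> with \<open>D j\<close> then settles the
      phase.\<close>
    then obtain j where j: "\<not> ereal s < U j" "ereal s < U (Suc j)"
      using ex_less_U[OF assms] ex_least_nat_less[of "\<lambda>k. ereal s < U k"] by (metis order_refl)
    show ?thesis
    proof (cases "ereal s < D j")
      case True
      then obtain u where "U j = ereal u" "a \<le> u" using j(1) U_cases[of j] by auto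
      moreover have "u \<le> s" using \<open>U j = ereal u\<close> j(1) by simp
      ultimately show ?thesis using True by (rule up)
    next
      case False
      then obtain d where "D j = ereal d" "a \<le> d" using P_cases[of "Suc j"] by (auto simp: P_Suc)
      moreover have "d \<le> s" using \<open>D j = ereal d\<close> False by simp
      ultimately show ?thesis using j(2) by (rule down)
    qed
  qed (rule initial)
qed

section \<open>Approximation of \<open>f\<close> within \<open>c / 2\<close>\<close>

lemma A_minus_B: "A k - B k = m k - m 0"
  \<comment> \<open>The \<open>M i\<close> and \<open>c\<close> cancel, and the differences
    \<open>m (Suc i) - m i\<close> telescope.\<close>
  by (induction k) (simp_all add: A_def B_def)

text \<open>After \<open>U 0\<close>, the next turning time has not come, so \<open>f\<close> is at
  most \<open>c\<close> away from the running extremum; \<open>A_minus_B\<close> reduces the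
  approximating function to that extremum shifted by \<open>c / 2\<close>.\<close>

lemma approx:
  assumes s: "a \<le> s" "s \<le> b"
  shows "\<bar>f s - (fU s - fD s + m 0 + c / 2)\<bar> \<le> c / 2"
  using s(2)
proof (cases rule: phase_cases)
  case initial
  define S where "S = {t\<in>{a..b}. P 0 \<le> ereal t \<and> ereal t < U 0}"
  have m: "m 0 = Inf (f ` S)" by (simp only: S_def m_tot_def)
  have sS: "s \<in> S" using s initial by (simp add: S_def P_0)
  then have "m 0 \<le> f s" unfolding m by (intro INF_le) (auto simp: S_def)
  moreover have "f s - c \<le> m 0"
    unfolding m
  proof (rule cINF_greatest)
    \<comment> \<open>\<open>m 0\<close> is an infimum over the entire initial phase, so
      \<open>t\<close> may lie on either side of \<open>s\<close>: an early \<open>t\<close> is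
      handled by the absence of a rise, a late one by the absence of a drop.\<close>
    fix t assume t: "t \<in> S"
    have "f s - f t < c"
    proof (cases "t \<le> s")
      case True
      then show ?thesis using rise_less[of a s t] initial s t U_eq[of 0] by (simp add: S_def P_0)
    next
      case False
      \<comment> \<open>Here \<open>rise_first\<close> enters: before \<open>U 0\<close> no drop by
        \<open>c\<close> occurs either.\<close>
      have "ereal t < next_D c b f (ereal a)"
        using t rise_first a_less_b
        by (simp add: S_def next_D_def T_D_def TU.simps less_le_trans[of _ "T_U c a b f"])
      then show ?thesis using drop_less[of a t s] False s t by (simp add: S_def)
    qed
    then show "f s - c \<le> f t" by simp
  qed (use sS in auto)
  ultimately show ?thesis using values_initial[OF initial] by linarith
next
  case (up k u)
  have "f s \<le> Sup (f ` {u..s})" using up s by (intro le_SUP) auto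
  moreover have "Sup (f ` {u..s}) \<le> f s + c"
  proof (rule cSUP_least)
    fix x assume "x \<in> {u..s}"
    then show "f x \<le> f s + c" using drop_less[of u s x] up s by (simp add: D_eq)
  qed (use up in auto)
  ultimately show ?thesis
    using values_up[OF up(1,3,4)] A_minus_B[of k] by linarith
next
  case (down k d)
  have "Inf (f ` {d..s}) \<le> f s" using down s by (intro INF_le) auto
  moreover have "f s - c \<le> Inf (f ` {d..s})"
  proof (rule cINF_greatest)
    fix x assume "x \<in> {d..s}"
    then show "f s - c \<le> f x" using rise_less[of d s x] down s U_eq[of "Suc k"] by (simp add: P_Suc)
  qed (use down in auto)
  moreover have "A (Suc k) - B k = M k - c - m 0"
    using A_minus_B[of k] by (simp add: A_def)
  ultimately show ?thesis
    using values_down[OF down(1,3,4)] by linarith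
qed

section \<open>Monotonicity of \<open>fU\<close> and \<open>fD\<close>\<close>

definition dominated :: "real \<Rightarrow> real \<Rightarrow> bool" where
  "dominated x y \<longleftrightarrow> fU x \<le> fU y \<and> fD x \<le> fD y"

text \<open>The endpoint \<open>y = U 0\<close> already obeys the upward formula: \<open>fU\<close>
  jumps there to \<open>f y - m 0 - c\<close>, nonnegative because the rise is attained.\<close>

lemma dominated_initial:
  assumes "x \<le> y" "ereal y \<le> U 0"
  shows "dominated x y"
proof (cases "ereal y < U 0 \<or> x = y")
  case True
  then show ?thesis
  proof
    assume y: "ereal y < U 0"
    then have x: "ereal x < U 0" using assms(1) by (rule ereal_less_mono_left[rotated])
    show ?thesis by (simp add: dominated_def values_initial x y)
  qed (simp add: dominated_def)
next
  case False
  then have y: "U 0 = ereal y" "x < y" using assms by auto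
  obtain p where "m 0 \<le> f y - c" by (rule U_finite[OF y(1)])
  moreover have "ereal y < D 0" using U_less_D[of 0] y by simp
  ultimately show ?thesis
    using y values_up[of 0 y y] values_initial[of x] by (simp add: dominated_def A_def B_def)
qed

text \<open>At the endpoint \<open>y = D k\<close> the running supremum in \<open>fU\<close> is
  replaced by \<open>M k\<close>, and \<open>fD\<close> jumps by \<open>M k - f y - c\<close>,
  nonnegative because the drop is attained.\<close>

lemma dominated_up:
  assumes u: "U k = ereal u" "a \<le> u" and xy: "u \<le> x" "x \<le> y" "y \<le> b" "ereal y \<le> D k"
  shows "dominated x y"
proof (cases "ereal y < D k \<or> x = y")
  case True
  then show ?thesis
  proof
    assume y: "ereal y < D k"
    then have x: "ereal x < D k" using xy(2) by (rule ereal_less_mono_left[rotated])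
    have "Sup (f ` {u..x}) \<le> Sup (f ` {u..y})" using u xy by (intro SUP_mono_set) auto
    then show ?thesis using values_up[OF u(1) _ x] values_up[OF u(1) _ y] xy by (simp add: dominated_def)
  qed (simp add: dominated_def)
next
  case False
  then have y: "D k = ereal y" "x < y" using xy by auto
  obtain u' where M: "U k = ereal u'" "M k = Sup (f ` {u'..<y})" "f y + c \<le> M k"
    by (rule D_finite[OF y(1)])
  have "Sup (f ` {u..x}) \<le> M k"
    unfolding M(2) using M(1) u xy y by (intro SUP_mono_set) auto
  moreover have "ereal y < U (Suc k)" using D_less_U_Suc[of k] y by simp
  ultimately show ?thesis
    using values_up[OF u(1), of x] values_down[OF y(1), of y] xy y M
    by (simp add: dominated_def A_def)
qed

lemma dominated_down:
  assumes d: "D k = ereal d" "a \<le> d" and xy: "d \<le> x" "x \<le> y" "y \<le> b" "ereal y \<le> U (Suc k)"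
  shows "dominated x y"
proof (cases "ereal y < U (Suc k) \<or> x = y")
  case True
  then show ?thesis
  proof
    assume y: "ereal y < U (Suc k)"
    then have x: "ereal x < U (Suc k)" using xy(2) by (rule ereal_less_mono_left[rotated])
    have "Inf (f ` {d..y}) \<le> Inf (f ` {d..x})" using d xy by (intro INF_antimono) auto
    then show ?thesis using values_down[OF d(1) _ x] values_down[OF d(1) _ y] xy by (simp add: dominated_def)
  qed (simp add: dominated_def)
next
  case False
  then have y: "U (Suc k) = ereal y" "x < y" using xy by auto
  obtain d' where m: "P (Suc k) = ereal d'" "m (Suc k) = Inf (f ` {d'..<y})" "m (Suc k) \<le> f y - c"
    by (rule U_finite[OF y(1)])
  have "m (Suc k) \<le> Inf (f ` {d..x})"
    unfolding m(2) using m(1) d xy y by (intro INF_antimono) (auto simp: P_Suc)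
  moreover have "ereal y < D (Suc k)" using U_less_D[of "Suc k"] y by simp
  ultimately show ?thesis
    using values_down[OF d(1), of x] values_up[OF y(1), of y] xy y m
    by (simp add: dominated_def B_def)
qed

text \<open>Each induction step extends the claim first to \<open>D k\<close>, then to
  \<open>U (Suc k)\<close>; points on different sides of a turning time are joined there by
  transitivity.\<close>

lemma dominated_until_U:
  assumes "a \<le> x" "x \<le> y" "y \<le> b" "ereal y \<le> U k"
  shows "dominated x y"
  using assms
proof (induction k arbitrary: x y)
  case 0
  then show ?case using dominated_initial by simp
next
  case (Suc k)
  have until_D: "dominated x y" if xy: "a \<le> x" "x \<le> y" "y \<le> b" "ereal y \<le> D k" for x y
  proof (cases "ereal y \<le> U k")
    case False
    then obtain u where u: "U k = ereal u" "a \<le> u" "u < y" using U_cases[of k] by auto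
    show ?thesis
    proof (cases "u \<le> x")
      case False
      have "dominated x u" using Suc.IH[of x u] False u xy by simp
      moreover have "dominated u y" using dominated_up[OF u(1,2), of u y] u xy by simp
      ultimately show ?thesis by (simp add: dominated_def)
    qed (use dominated_up u xy in blast)
  qed (use Suc.IH xy in blast)
  note xy = Suc.prems
  show ?case
  proof (cases "ereal y \<le> D k")
    case False
    then obtain d where d: "D k = ereal d" "a \<le> d" "d < y"
      using P_cases[of "Suc k"] by (auto simp: P_Suc)
    show ?thesis
    proof (cases "d \<le> x")
      case False
      have "dominated x d" using until_D[of x d] False d xy by simp
      moreover have "dominated d y" using dominated_down[OF d(1,2), of d y] d xy by simp
      ultimately show ?thesis by (simp add: dominated_def)
    qed (use dominated_down d xy in blast)
  qed (use until_D xy in blast)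
qed

lemma fU_mono: "a \<le> x \<Longrightarrow> x \<le> y \<Longrightarrow> y \<le> b \<Longrightarrow> fU x \<le> fU y"
  and fD_mono: "a \<le> x \<Longrightarrow> x \<le> y \<Longrightarrow> y \<le> b \<Longrightarrow> fD x \<le> fD y"
proof -
  assume xy: "a \<le> x" "x \<le> y" "y \<le> b"
  then obtain k where "ereal y < U k" using ex_less_U by blast
  then have "dominated x y" using xy by (intro dominated_until_U[of x y k]) auto
  then show "fU x \<le> fU y" "fD x \<le> fD y" by (simp_all add: dominated_def)
qed

section \<open>Upper bounds for \<open>UTV\<close> and \<open>DTV\<close>\<close>

lemma increment_le:
  assumes "a \<le> x" "x \<le> y" "y \<le> b"
  shows "max (f y - f x - c) 0 \<le> fU y - fU x" "max (f x - f y - c) 0 \<le> fD y - fD x"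
  \<comment> \<open>Two uses of \<open>approx\<close> bound \<open>f y - f x - c\<close> by the
    increment of \<open>fU - fD\<close>, and monotonicity of \<open>fD\<close> discards its share.
    The other bound is symmetric.\<close>
  using approx[of x] approx[of y] fU_mono[OF assms] fD_mono[OF assms] assms
  by linarith+

lemma UTV_DTV_le:
  assumes s: "a < s" "s \<le> b"
  shows "UTV c f a s \<le> ereal (fU s)" "DTV c f a s \<le> ereal (fD s)"
proof -
  have zero: "fU a = 0" "fD a = 0" using values_initial a_less_U by simp_all
  show "UTV c f a s \<le> ereal (fU s)"
    unfolding UTV_def
  proof (intro SUP_least)
    fix n t assume t: "t \<in> partitions a s n"
    have "(\<Sum>i=1..n. max (f (t i) - f (t (i - 1)) - c) 0) \<le> fU s"
      by (rule partition_sum_le[OF t, where F = fU and g = "\<lambda>x y. max (f y - f x - c) 0"])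
        (use s zero in \<open>auto intro: increment_le(1) fU_mono simp del: max.bounded_iff\<close>)
    then show "ereal (\<Sum>i=1..n. max (f (t i) - f (t (i - 1)) - c) 0) \<le> ereal (fU s)" by simp
  qed
  show "DTV c f a s \<le> ereal (fD s)"
    unfolding DTV_def
  proof (intro SUP_least)
    fix n t assume t: "t \<in> partitions a s n"
    have "(\<Sum>i=1..n. max (f (t (i - 1)) - f (t i) - c) 0) \<le> fD s"
      by (rule partition_sum_le[OF t, where F = fD and g = "\<lambda>x y. max (f x - f y - c) 0"])
        (use s zero in \<open>auto intro: increment_le(2) fD_mono simp del: max.bounded_iff\<close>)
    then show "ereal (\<Sum>i=1..n. max (f (t (i - 1)) - f (t i) - c) 0) \<le> ereal (fD s)" by simp
  qed
qed

section \<open>Lower bound for \<open>TV\<close> by explicit partitions\<close>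

text \<open>Unlike in \<^const>\<open>TV\<close>, the one-point partition is allowed here.\<close>

definition reach :: "real \<Rightarrow> real \<Rightarrow> bool" where
  "reach x r \<longleftrightarrow> (\<exists>n t. t \<in> partitions a x n \<and> t n = x \<and>
     r \<le> (\<Sum>i=1..n. max (\<bar>f (t i) - f (t (i - 1))\<bar> - c) 0))"

lemma reach_refl: "a \<le> x \<Longrightarrow> reach x 0"
  unfolding reach_def
  by (rule exI[of _ 0], rule exI[of _ "\<lambda>_. x"]) (simp add: partitions_def)

text \<open>Appending \<open>y\<close> adds a truncated term, which is at least
  \<open>\<bar>f y - f x\<bar> - c\<close> whatever the sign of the latter.\<close>

lemma reach_step:
  assumes "reach x r" "x < y" "r' \<le> r + (\<bar>f y - f x\<bar> - c)"
  shows "reach y r'"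
proof -
  obtain n t where t: "t \<in> partitions a x n" "t n = x"
    "r \<le> (\<Sum>i=1..n. max (\<bar>f (t i) - f (t (i - 1))\<bar> - c) 0)"
    using assms(1) by (auto simp: reach_def)
  define t' where "t' = t(Suc n := y)"
  have eq: "t' i = t i" if "i \<le> n" for i using that by (simp add: t'_def)
  have last: "t' (Suc n) = y" by (simp add: t'_def)
  have part: "t' \<in> partitions a y (Suc n)"
    using t(1,2) assms(2) by (auto simp: partitions_def t'_def less_Suc_eq)
  have "(\<Sum>i=1..n. max (\<bar>f (t' i) - f (t' (i - 1))\<bar> - c) 0) =
        (\<Sum>i=1..n. max (\<bar>f (t i) - f (t (i - 1))\<bar> - c) 0)"
    by (intro sum.cong) (auto simp: eq)
  moreover have "(\<Sum>i=1..Suc n. max (\<bar>f (t' i) - f (t' (i - 1))\<bar> - c) 0) =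
    (\<Sum>i=1..n. max (\<bar>f (t' i) - f (t' (i - 1))\<bar> - c) 0) + max (\<bar>f y - f x\<bar> - c) 0"
    using t(2) by (simp add: last eq)
  ultimately have "r' \<le> (\<Sum>i=1..Suc n. max (\<bar>f (t' i) - f (t' (i - 1))\<bar> - c) 0)"
    using t(3) assms(3) by linarith
  then show ?thesis using part last unfolding reach_def by blast
qed

lemma reach_le_TV:
  assumes "reach x r" "x \<le> s" "a < s"
  shows "ereal r \<le> TV c f a s"
proof -
  obtain n t where t: "t \<in> partitions a x n"
    "r \<le> (\<Sum>i=1..n. max (\<bar>f (t i) - f (t (i - 1))\<bar> - c) 0)"
    using assms(1) by (auto simp: reach_def)
  obtain n' t' where t': "n' \<ge> 1" "t' \<in> partitions a s n'"
    "r \<le> (\<Sum>i=1..n'. max (\<bar>f (t' i) - f (t' (i - 1))\<bar> - c) 0)"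
  proof (cases n)
    case 0
    have "(\<lambda>i. if i = 0 then a else s) \<in> partitions a s 1"
      using assms(3) by (simp add: partitions_def)
    then show ?thesis
      by (rule that[of 1, OF order_refl]) (use 0 t(2) in simp)
  next
    case (Suc n')
    show ?thesis
      by (rule that[of n t]) (use Suc t assms(2) in \<open>auto simp: partitions_def\<close>)
  qed
  have "ereal (\<Sum>i=1..n'. max (\<bar>f (t' i) - f (t' (i - 1))\<bar> - c) 0) \<le> TV c f a s"
    unfolding TV_def using t' by (intro SUP_upper2[of n'] SUP_upper) auto
  then show ?thesis using t'(3) by (meson ereal_less_eq(3) order_trans)
qed

lemma reach_weaken: "reach x r \<Longrightarrow> r' \<le> r \<Longrightarrow> reach x r'"
  unfolding reach_def using order_trans by blast

text \<open>From a near-minimum \<open>x\<close> reached before \<open>u\<close>, the step to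
  \<open>y\<close> gains \<open>f y - f x - c\<close>. The error is halved: one part for
  \<open>f x\<close>, one for the sum so far.\<close>

lemma reach_up:
  assumes before: "\<And>e. e > 0 \<Longrightarrow> \<exists>x<u. f x < m k + e \<and> reach x (A k + B k - e)"
    and y: "u \<le> y" and e: "e > 0"
  shows "reach y (A k + B k + f y - m k - c - e)"
proof -
  obtain x where x: "x < u" "f x < m k + e / 2" "reach x (A k + B k - e / 2)"
    using before[of "e / 2"] e by auto
  show ?thesis by (rule reach_step[OF x(3)]) (use x y in linarith)+
qed

lemma reach_down:
  assumes before: "\<And>e. e > 0 \<Longrightarrow> \<exists>x<d. f x > M k - e \<and> reach x (A (Suc k) + B k - e)"
    and y: "d \<le> y" and e: "e > 0"
  shows "reach y (A (Suc k) + B k + M k - f y - c - e)"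
proof -
  obtain x where x: "x < d" "f x > M k - e / 2" "reach x (A (Suc k) + B k - e / 2)"
    using before[of "e / 2"] e by auto
  show ?thesis by (rule reach_step[OF x(3)]) (use x y in linarith)+
qed

text \<open>The premise \<open>before\<close> is what \<open>reach_before_U\<close> proves; keeping
  it as a premise allows use within the induction there.\<close>

lemma reach_before_D_if:
  assumes before: "\<And>u e. U k = ereal u \<Longrightarrow> e > 0 \<Longrightarrow> \<exists>x<u. f x < m k + e \<and> reach x (A k + B k - e)"
    and d: "D k = ereal d" and e: "e > 0"
  shows "\<exists>x<d. f x > M k - e \<and> reach x (A (Suc k) + B k - e)"
proof (rule D_finite[OF d])
  fix u assume u: "U k = ereal u" "u < d" and M: "M k = Sup (f ` {u..<d})"
  obtain x where x: "x \<in> {u..<d}" "f x > M k - e / 2"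
    using ex_near_SUP[of "{u..<d}" "e / 2"] u e M by auto
  have "reach x (A k + B k + f x - m k - c - e / 2)"
    using x e by (intro reach_up[OF before[OF u(1)]]) auto
  then have "reach x (A (Suc k) + B k - e)"
    by (rule reach_weaken) (use x in \<open>simp add: A_def\<close>)
  then show ?thesis using x e by (intro exI[of _ x]) auto
qed

text \<open>Alternates near-minima and near-maxima of successive phases. The strict
  \<open>x < u\<close> matters: partition points increase strictly, and the next one may be
  \<open>u\<close> itself.\<close>

lemma reach_before_U:
  "U k = ereal u \<Longrightarrow> e > 0 \<Longrightarrow> \<exists>x<u. f x < m k + e \<and> reach x (A k + B k - e)"
proof (induction k arbitrary: u e)
  case 0
  show ?case
  proof (rule U_finite[OF 0(1)])
    fix p assume p: "P 0 = ereal p" "a \<le> p" "p < u" and m: "m 0 = Inf (f ` {p..<u})"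
    obtain x where x: "x \<in> {p..<u}" "f x < m 0 + e"
      using ex_near_INF[of "{p..<u}" e] p 0(2) m by auto
    have "reach x 0" using x p by (intro reach_refl) auto
    then have "reach x (A 0 + B 0 - e)"
      by (rule reach_weaken) (use 0(2) in \<open>simp add: A_def B_def\<close>)
    then show ?thesis using x by auto
  qed
next
  case (Suc k)
  show ?case
  proof (rule U_finite[OF Suc.prems(1)])
    fix d assume d: "P (Suc k) = ereal d" "d < u" and m: "m (Suc k) = Inf (f ` {d..<u})"
    obtain x where x: "x \<in> {d..<u}" "f x < m (Suc k) + e / 2"
      using ex_near_INF[of "{d..<u}" "e / 2"] d Suc.prems(2) m by auto
    have Dk: "D k = ereal d" using d by (simp add: P_Suc)
    have "reach x (A (Suc k) + B k + M k - f x - c - e / 2)"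
      using x Suc.prems(2) by (intro reach_down[OF reach_before_D_if[OF Suc.IH Dk]]) auto
    then have "reach x (A (Suc k) + B (Suc k) - e)"
      by (rule reach_weaken) (use x in \<open>simp add: B_def\<close>)
    then show ?thesis using x Suc.prems(2) by (intro exI[of _ x]) auto
  qed
qed

lemma reach_before_D:
  "D k = ereal d \<Longrightarrow> e > 0 \<Longrightarrow> \<exists>x<d. f x > M k - e \<and> reach x (A (Suc k) + B k - e)"
  by (rule reach_before_D_if) (rule reach_before_U)

lemma TV_ge:
  assumes s: "a < s" "s \<le> b"
  shows "ereal (fU s + fD s) \<le> TV c f a s"
proof -
  \<comment> \<open>The partition ends at a near-extremal point \<open>x\<close> of the current
    phase, which may lie before \<open>s\<close>.\<close>
  have near: "\<exists>x\<le>s. reach x (fU s + fD s - e)" if e: "e > 0" for e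
    using s(2)
  proof (cases rule: phase_cases)
    case initial
    have "reach s (fU s + fD s - e)"
      by (rule reach_weaken[OF reach_refl]) (use s e in \<open>simp_all add: values_initial[OF initial]\<close>)
    then show ?thesis by auto
  next
    case (up k u)
    obtain x where x: "x \<in> {u..s}" "f x > Sup (f ` {u..s}) - e / 2"
      using ex_near_SUP[of "{u..s}" "e / 2"] up e by auto
    have "reach x (A k + B k + f x - m k - c - e / 2)"
      using x e by (intro reach_up[OF reach_before_U[OF up(1)]]) auto
    then have "reach x (fU s + fD s - e)"
      by (rule reach_weaken) (use x values_up[OF up(1,3,4)] in linarith)
    then show ?thesis using x by auto
  next
    case (down k d)
    obtain x where x: "x \<in> {d..s}" "f x < Inf (f ` {d..s}) + e / 2"
      using ex_near_INF[of "{d..s}" "e / 2"] down e by auto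
    have "reach x (A (Suc k) + B k + M k - f x - c - e / 2)"
      using x e by (intro reach_down[OF reach_before_D[OF down(1)]]) auto
    then have "reach x (fU s + fD s - e)"
      by (rule reach_weaken) (use x values_down[OF down(1,3,4)] in linarith)
    then show ?thesis using x by auto
  qed
  show ?thesis
  proof (rule ereal_le_epsilon2)
    fix e :: real assume "0 < e"
    then have "ereal (fU s + fD s - e) \<le> TV c f a s" using near reach_le_TV s(1) by blast
    then show "ereal (fU s + fD s) \<le> TV c f a s + ereal e"
      by (cases "TV c f a s") auto
  qed
qed

text \<open>The chain \<open>fU s + fD s \<le> TV \<le> UTV + DTV \<le> fU s + fD s\<close> has
  finite ends, so no summand can have slack.\<close>

lemma variations_eq:
  assumes s: "a < s" "s \<le> b"
  shows "UTV c f a s = ereal (fU s) \<and> DTV c f a s = ereal (fD s) \<and>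
    TV c f a s = ereal (fU s + fD s)"
proof -
  have "TV c f a s \<le> UTV c f a s + DTV c f a s" using c_pos by (intro TV_le_UTV_plus_DTV) simp
  with UTV_DTV_le[OF s] TV_ge[OF s] show ?thesis
    by (cases "UTV c f a s"; cases "DTV c f a s"; cases "TV c f a s") auto
qed

end

theorem theorem4p1:
  fixes a b c s :: real and f :: "real \<Rightarrow> real"
  assumes "a < b" and "c > 0" and "cadlag_on a b f" and "s \<in> {a<..b}"
  shows "UTV c f a s = ereal (f_U c a b f s) \<and>
         DTV c f a s = ereal (f_D c a b f s) \<and>
         TV c f a s = ereal (f_U c a b f s + f_D c a b f s)"
proof -
  have cadlag_fun: "cadlag_fun a b c f"
    using assms by (simp add: cadlag_fun_def)
  have s: "a < s" "s \<le> b" using assms by auto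
  show ?thesis
  proof (cases "T_U c a b f \<le> T_D c a b f")
    case True
    then have "rise_first a b c f" using cadlag_fun by (simp add: rise_first_def rise_first_axioms_def)
    from rise_first.variations_eq[OF this s] True show ?thesis by (simp add: f_U_def f_D_def)
  next
    case False
    \<comment> \<open>Rise and drop times of \<open>-f\<close> are exchanged, so the case assumption
      yields that of \<open>rise_first\<close>.\<close>
    then have "T_U c a b (\<lambda>x. - f x) \<le> T_D c a b (\<lambda>x. - f x)"
      by (simp add: T_U_def T_D_def rise_time_uminus drop_time_uminus)
    then have "rise_first a b c (\<lambda>x. - f x)"
      using cadlag_fun.cadlag_fun_uminus[OF cadlag_fun] by (simp add: rise_first_def rise_first_axioms_def)
    \<comment> \<open>Negation exchanges \<open>UTV\<close> and \<open>DTV\<close>, just as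
      \<open>f_U\<close> and \<open>f_D\<close> here take the base functions of \<open>-f\<close>
      crosswise.\<close>
    from rise_first.variations_eq[OF this s] False show ?thesis
      by (simp add: f_U_def f_D_def UTV_uminus DTV_uminus TV_uminus add.commute)
  qed
qed

end
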